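(* Let $F:\mathcal{A}\to\mathcal{C}$ and $G:\mathcal{B}\to\mathcal{C}$ be functors, $\mathcal{G}=(F\downarrow G)$. Assume $\mathcal{A}$ is regular and $F$ is faithful and has a right adjoint $F^{\star}$ with counit $\theta:FF^{\star}\to\mathrm{id}_{\mathcal{C}}$. For $(A,f,B)$ in $\mathcal{G}$ let $\hat f:A\to F^{\star}G(B)$ be the unique morphism with $\theta_{G(B)}\circ F(\hat f)=f$, let $\hat f=m_{\hat f}\circ e_{\hat f}$ be an image factorization ($e_{\hat f}:A\to\mathrm{Ran}(\hat f)$ a regular epimorphism, $m_{\hat f}:\mathrm{Ran}(\hat f)\to F^{\star}G(B)$ a monomorphism), define $\mathcal{S}(A,f,B)=(\mathrm{Ran}(\hat f),\theta_{G(B)}\circ F(m_{\hat f}),B)$ and $\eta_{(A,f,B)}=(e_{\hat f},\mathrm{id}_B):(A,f,B)\to\mathcal{S}(A,f,B)$. If $(\phi,\psi):(A,f,B)\to(A',f',B')$ is a morphism in $\mathcal{G}$ and $(A',f',B')$ is simple, then there is a unique morphism $(\hat\phi,\hat\psi):\mathcal{S}(A,f,B)\to(A',f',B')$ in $\mathcal{G}$ such that $(\hat\phi,\hat\psi)\circ\eta_{(A,f,B)}=(\phi,\psi)$.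
   Context: The comma category $(F\downarrow G)$ has objects $(A,f,B)$ with $A\in\mathcal{A}$, $B\in\mathcal{B}$, $f:F(A)\to G(B)$ in $\mathcal{C}$, and morphisms $(\phi,\psi):(A,f,B)\to(A',f',B')$ with $f'\circ F(\phi)=G(\psi)\circ f$; composition is componentwise. An object $(A,f,B)$ is simple if $f$ is a monomorphism in $\mathcal{C}$. *)

theory Defs
  imports Main
begin

section \<open>Categories, functors, natural transformations\<close>

record ('o, 'm) cat =
  Obj :: "'o set"
  Arr :: "'m set"
  Dom :: "'m \<Rightarrow> 'o"
  Cod :: "'m \<Rightarrow> 'o"
  Ident :: "'o \<Rightarrow> 'm"
  Comp :: "'m \<Rightarrow> 'm \<Rightarrow> 'm"  (infixl "\<bullet>\<index>" 70)

text \<open>\<open>g \<bullet>\<^bsub>C\<^esub> f\<close> is ``first \<open>f\<close>, then \<open>g\<close>''; its value is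
  irrelevant unless \<open>Dom C g = Cod C f\<close>.\<close>

definition hom :: "('o, 'm) cat \<Rightarrow> 'o \<Rightarrow> 'o \<Rightarrow> 'm set" where
  "hom C X Y = {f \<in> Arr C. Dom C f = X \<and> Cod C f = Y}"

locale category =
  fixes C :: "('o, 'm) cat" (structure)
  assumes Dom_in_Obj: "f \<in> Arr C \<Longrightarrow> Dom C f \<in> Obj C"
    and Cod_in_Obj: "f \<in> Arr C \<Longrightarrow> Cod C f \<in> Obj C"
    and Ident_in_hom: "X \<in> Obj C \<Longrightarrow> Ident C X \<in> hom C X X"
    and Comp_in_hom: "f \<in> hom C X Y \<Longrightarrow> g \<in> hom C Y Z \<Longrightarrow> g \<bullet> f \<in> hom C X Z"
    and Ident_left: "f \<in> hom C X Y \<Longrightarrow> Ident C Y \<bullet> f = f"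
    and Ident_right: "f \<in> hom C X Y \<Longrightarrow> f \<bullet> Ident C X = f"
    and Comp_assoc: "f \<in> hom C W X \<Longrightarrow> g \<in> hom C X Y \<Longrightarrow> h \<in> hom C Y Z \<Longrightarrow>
      h \<bullet> (g \<bullet> f) = (h \<bullet> g) \<bullet> f"

record ('o1, 'm1, 'o2, 'm2) func =
  ob :: "'o1 \<Rightarrow> 'o2"
  ar :: "'m1 \<Rightarrow> 'm2"

locale is_functor = dom: category A + cod: category C
  for A :: "('o1, 'm1) cat" and C :: "('o2, 'm2) cat" +
  fixes F :: "('o1, 'm1, 'o2, 'm2) func"
  assumes ob_in_Obj: "X \<in> Obj A \<Longrightarrow> ob F X \<in> Obj C"
    and ar_in_hom: "f \<in> hom A X Y \<Longrightarrow> ar F f \<in> hom C (ob F X) (ob F Y)"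
    and ar_Ident: "X \<in> Obj A \<Longrightarrow> ar F (Ident A X) = Ident C (ob F X)"
    and ar_Comp: "f \<in> hom A X Y \<Longrightarrow> g \<in> hom A Y Z \<Longrightarrow>
      ar F (g \<bullet>\<^bsub>A\<^esub> f) = ar F g \<bullet>\<^bsub>C\<^esub> ar F f"

definition faithful :: "('o1, 'm1) cat \<Rightarrow> ('o1, 'm1, 'o2, 'm2) func \<Rightarrow> bool" where
  "faithful A F \<longleftrightarrow> (\<forall>X \<in> Obj A. \<forall>Y \<in> Obj A. inj_on (ar F) (hom A X Y))"

definition id_func :: "('o, 'm, 'o, 'm) func" where
  "id_func = \<lparr>ob = (\<lambda>X. X), ar = (\<lambda>f. f)\<rparr>"

definition comp_func ::
  "('o2, 'm2, 'o3, 'm3) func \<Rightarrow> ('o1, 'm1, 'o2, 'm2) func \<Rightarrow> ('o1, 'm1, 'o3, 'm3) func" where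
  "comp_func G F = \<lparr>ob = (\<lambda>X. ob G (ob F X)), ar = (\<lambda>f. ar G (ar F f))\<rparr>"

definition nat_trans ::
  "('o1, 'm1) cat \<Rightarrow> ('o2, 'm2) cat \<Rightarrow> ('o1, 'm1, 'o2, 'm2) func \<Rightarrow>
   ('o1, 'm1, 'o2, 'm2) func \<Rightarrow> ('o1 \<Rightarrow> 'm2) \<Rightarrow> bool" where
  "nat_trans A C F G \<tau> \<longleftrightarrow>
     is_functor A C F \<and> is_functor A C G \<and>
     (\<forall>X \<in> Obj A. \<tau> X \<in> hom C (ob F X) (ob G X)) \<and>
     (\<forall>X Y. \<forall>f \<in> hom A X Y. \<tau> Y \<bullet>\<^bsub>C\<^esub> ar F f = ar G f \<bullet>\<^bsub>C\<^esub> \<tau> X)"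

definition right_adjoint_with_counit ::
  "('o1, 'm1) cat \<Rightarrow> ('o2, 'm2) cat \<Rightarrow> ('o1, 'm1, 'o2, 'm2) func \<Rightarrow>
   ('o2, 'm2, 'o1, 'm1) func \<Rightarrow> ('o2 \<Rightarrow> 'm2) \<Rightarrow> bool" where
  "right_adjoint_with_counit A C F F' \<theta> \<longleftrightarrow>
     is_functor A C F \<and> is_functor C A F' \<and>
     nat_trans C C (comp_func F F') id_func \<theta> \<and>
     (\<exists>\<iota>. nat_trans A A id_func (comp_func F' F) \<iota> \<and>
       (\<forall>X \<in> Obj A. \<theta> (ob F X) \<bullet>\<^bsub>C\<^esub> ar F (\<iota> X) = Ident C (ob F X)) \<and>
       (\<forall>Y \<in> Obj C. ar F' (\<theta> Y) \<bullet>\<^bsub>A\<^esub> \<iota> (ob F' Y) = Ident A (ob F' Y)))"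


section \<open>Monomorphisms, regular epimorphisms, regular categories\<close>

definition monomorphism :: "('o, 'm) cat \<Rightarrow> 'm \<Rightarrow> bool" where
  "monomorphism C m \<longleftrightarrow> m \<in> Arr C \<and>
     (\<forall>W. \<forall>g \<in> hom C W (Dom C m). \<forall>h \<in> hom C W (Dom C m).
        m \<bullet>\<^bsub>C\<^esub> g = m \<bullet>\<^bsub>C\<^esub> h \<longrightarrow> g = h)"

definition coequalizer :: "('o, 'm) cat \<Rightarrow> 'm \<Rightarrow> 'm \<Rightarrow> 'm \<Rightarrow> bool" where
  "coequalizer C u v e \<longleftrightarrow>
     (\<exists>X Y Q. u \<in> hom C X Y \<and> v \<in> hom C X Y \<and> e \<in> hom C Y Q \<and>
        e \<bullet>\<^bsub>C\<^esub> u = e \<bullet>\<^bsub>C\<^esub> v \<and>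
        (\<forall>Z. \<forall>h \<in> hom C Y Z. h \<bullet>\<^bsub>C\<^esub> u = h \<bullet>\<^bsub>C\<^esub> v \<longrightarrow>
           (\<exists>!k. k \<in> hom C Q Z \<and> k \<bullet>\<^bsub>C\<^esub> e = h)))"

definition regular_epi :: "('o, 'm) cat \<Rightarrow> 'm \<Rightarrow> bool" where
  "regular_epi C e \<longleftrightarrow> (\<exists>u v. coequalizer C u v e)"

definition pullback :: "('o, 'm) cat \<Rightarrow> 'm \<Rightarrow> 'm \<Rightarrow> 'm \<Rightarrow> 'm \<Rightarrow> bool" where
  "pullback C f g p q \<longleftrightarrow>
     (\<exists>X Y Z P. f \<in> hom C X Z \<and> g \<in> hom C Y Z \<and> p \<in> hom C P X \<and> q \<in> hom C P Y \<and>
        f \<bullet>\<^bsub>C\<^esub> p = g \<bullet>\<^bsub>C\<^esub> q \<and>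
        (\<forall>T. \<forall>x \<in> hom C T X. \<forall>y \<in> hom C T Y. f \<bullet>\<^bsub>C\<^esub> x = g \<bullet>\<^bsub>C\<^esub> y \<longrightarrow>
           (\<exists>!t. t \<in> hom C T P \<and> p \<bullet>\<^bsub>C\<^esub> t = x \<and> q \<bullet>\<^bsub>C\<^esub> t = y)))"

definition cone :: "('j, 'k) cat \<Rightarrow> ('o, 'm) cat \<Rightarrow> ('j, 'k, 'o, 'm) func \<Rightarrow>
    'o \<Rightarrow> ('j \<Rightarrow> 'm) \<Rightarrow> bool" where
  "cone J C D X \<pi> \<longleftrightarrow> X \<in> Obj C \<and>
     (\<forall>j \<in> Obj J. \<pi> j \<in> hom C X (ob D j)) \<and>
     (\<forall>i j. \<forall>a \<in> hom J i j. ar D a \<bullet>\<^bsub>C\<^esub> \<pi> i = \<pi> j)"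

definition limit_cone :: "('j, 'k) cat \<Rightarrow> ('o, 'm) cat \<Rightarrow> ('j, 'k, 'o, 'm) func \<Rightarrow>
    'o \<Rightarrow> ('j \<Rightarrow> 'm) \<Rightarrow> bool" where
  "limit_cone J C D X \<pi> \<longleftrightarrow> cone J C D X \<pi> \<and>
     (\<forall>Y \<sigma>. cone J C D Y \<sigma> \<longrightarrow>
        (\<exists>!h. h \<in> hom C Y X \<and> (\<forall>j \<in> Obj J. \<pi> j \<bullet>\<^bsub>C\<^esub> h = \<sigma> j)))"

text \<open>Every finite category is isomorphic to one whose objects and arrows are natural
  numbers, so diagrams of type \<open>(nat, nat) cat\<close> are all finite diagrams up to
  isomorphism.\<close>

definition finitely_complete :: "('o, 'm) cat \<Rightarrow> bool" where
  "finitely_complete C \<longleftrightarrow>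
     (\<forall>(J :: (nat, nat) cat) D.
        category J \<and> finite (Obj J) \<and> finite (Arr J) \<and> is_functor J C D \<longrightarrow>
        (\<exists>X \<pi>. limit_cone J C D X \<pi>))"

definition regular_category :: "('o, 'm) cat \<Rightarrow> bool" where
  "regular_category C \<longleftrightarrow> category C \<and> finitely_complete C \<and>
     (\<forall>f p q. pullback C f f p q \<longrightarrow> (\<exists>e. coequalizer C p q e)) \<and>
     (\<forall>e g p q. regular_epi C e \<and> pullback C g e p q \<longrightarrow> regular_epi C p)"

text \<open>The image \<open>Ran(g)\<close> is the common object \<open>Cod C e = Dom C m\<close>.\<close>

definition image_factorization :: "('o, 'm) cat \<Rightarrow> 'm \<Rightarrow> 'm \<Rightarrow> 'm \<Rightarrow> bool" where
  "image_factorization C g e m \<longleftrightarrow>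
     regular_epi C e \<and> monomorphism C m \<and> Cod C e = Dom C m \<and> m \<bullet>\<^bsub>C\<^esub> e = g"


section \<open>The comma category and simplification\<close>

type_synonym ('oa, 'mc, 'ob) comma_obj = "'oa \<times> 'mc \<times> 'ob"

text \<open>A morphism carries its source and target: the same pair \<open>(\<phi>, \<psi>)\<close> may be a
  morphism between several pairs of objects.\<close>

type_synonym ('oa, 'ma, 'mc, 'ob, 'mb) comma_arr =
  "('oa, 'mc, 'ob) comma_obj \<times> ('ma \<times> 'mb) \<times> ('oa, 'mc, 'ob) comma_obj"

definition comma_objs where
  "comma_objs A B C F G =
     {(a, f, b). a \<in> Obj A \<and> b \<in> Obj B \<and> f \<in> hom C (ob F a) (ob G b)}"

definition comma_arrs where
  "comma_arrs A B C F G =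
     {((a, f, b), (\<phi>, \<psi>), (a', f', b')).
        (a, f, b) \<in> comma_objs A B C F G \<and> (a', f', b') \<in> comma_objs A B C F G \<and>
        \<phi> \<in> hom A a a' \<and> \<psi> \<in> hom B b b' \<and>
        f' \<bullet>\<^bsub>C\<^esub> ar F \<phi> = ar G \<psi> \<bullet>\<^bsub>C\<^esub> f}"

definition comma ::
  "('oa, 'ma) cat \<Rightarrow> ('ob, 'mb) cat \<Rightarrow> ('oc, 'mc) cat \<Rightarrow>
   ('oa, 'ma, 'oc, 'mc) func \<Rightarrow> ('ob, 'mb, 'oc, 'mc) func \<Rightarrow>
   (('oa, 'mc, 'ob) comma_obj, ('oa, 'ma, 'mc, 'ob, 'mb) comma_arr) cat" where
  "comma A B C F G =
     \<lparr>Obj = comma_objs A B C F G,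
      Arr = comma_arrs A B C F G,
      Dom = (\<lambda>(X, p, Y). X),
      Cod = (\<lambda>(X, p, Y). Y),
      Ident = (\<lambda>(a, f, b). ((a, f, b), (Ident A a, Ident B b), (a, f, b))),
      Comp = (\<lambda>(Y, (\<phi>', \<psi>'), Z) (X, (\<phi>, \<psi>), Y').
                (X, (\<phi>' \<bullet>\<^bsub>A\<^esub> \<phi>, \<psi>' \<bullet>\<^bsub>B\<^esub> \<psi>), Z))\<rparr>"

definition simple_obj :: "('oc, 'mc) cat \<Rightarrow> ('oa, 'mc, 'ob) comma_obj \<Rightarrow> bool" where
  "simple_obj C = (\<lambda>(a, f, b). monomorphism C f)"

definition is_transpose ::
  "('oa, 'ma) cat \<Rightarrow> ('oc, 'mc) cat \<Rightarrow> ('oa, 'ma, 'oc, 'mc) func \<Rightarrow>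
   ('ob, 'mb, 'oc, 'mc) func \<Rightarrow> ('oc, 'mc, 'oa, 'ma) func \<Rightarrow> ('oc \<Rightarrow> 'mc) \<Rightarrow>
   ('oa, 'mc, 'ob) comma_obj \<Rightarrow> 'ma \<Rightarrow> bool" where
  "is_transpose A C F G F' \<theta> = (\<lambda>(a, f, b) fh.
     fh \<in> hom A a (ob F' (ob G b)) \<and> \<theta> (ob G b) \<bullet>\<^bsub>C\<^esub> ar F fh = f)"

text \<open>The simplification and its unit depend on the chosen image factorization \<open>(e, m)\<close>
  of the transpose.\<close>

definition simplification ::
  "('oa, 'ma) cat \<Rightarrow> ('oc, 'mc) cat \<Rightarrow> ('oa, 'ma, 'oc, 'mc) func \<Rightarrow>
   ('ob, 'mb, 'oc, 'mc) func \<Rightarrow> ('oc \<Rightarrow> 'mc) \<Rightarrow> 'ma \<Rightarrow>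
   ('oa, 'mc, 'ob) comma_obj \<Rightarrow> ('oa, 'mc, 'ob) comma_obj" where
  "simplification A C F G \<theta> m = (\<lambda>(a, f, b).
     (Dom A m, \<theta> (ob G b) \<bullet>\<^bsub>C\<^esub> ar F m, b))"

definition simplification_unit ::
  "('oa, 'ma) cat \<Rightarrow> ('ob, 'mb) cat \<Rightarrow> ('oc, 'mc) cat \<Rightarrow> ('oa, 'ma, 'oc, 'mc) func \<Rightarrow>
   ('ob, 'mb, 'oc, 'mc) func \<Rightarrow> ('oc \<Rightarrow> 'mc) \<Rightarrow> 'ma \<Rightarrow> 'ma \<Rightarrow>
   ('oa, 'mc, 'ob) comma_obj \<Rightarrow> ('oa, 'ma, 'mc, 'ob, 'mb) comma_arr" where
  "simplification_unit A B C F G \<theta> e m = (\<lambda>(a, f, b).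
     ((a, f, b), (e, Ident B b), simplification A C F G \<theta> m (a, f, b)))"

lemma hom_comma:
  "((a1, f1, b1), (\<phi>, \<psi>), (a2, f2, b2)) \<in> hom (comma A B C F G) (a, f, b) (a', f', b') \<longleftrightarrow>
     (a1, f1, b1) = (a, f, b) \<and> (a2, f2, b2) = (a', f', b') \<and>
     a \<in> Obj A \<and> b \<in> Obj B \<and> f \<in> hom C (ob F a) (ob G b) \<and>
     a' \<in> Obj A \<and> b' \<in> Obj B \<and> f' \<in> hom C (ob F a') (ob G b') \<and>
     \<phi> \<in> hom A a a' \<and> \<psi> \<in> hom B b b' \<and>
     f' \<bullet>\<^bsub>C\<^esub> ar F \<phi> = ar G \<psi> \<bullet>\<^bsub>C\<^esub> f"
  unfolding hom_def[of "comma A B C F G"]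
  by (auto simp: comma_def comma_objs_def comma_arrs_def)

lemma category_comma:
  assumes "is_functor A C F" "is_functor B C G"
  shows "category (comma A B C F G)"
proof -
  interpret F: is_functor A C F by fact
  interpret G: is_functor B C G by fact
  have comp: "f'' \<bullet>\<^bsub>C\<^esub> ar F (\<phi>' \<bullet>\<^bsub>A\<^esub> \<phi>) = ar G (\<psi>' \<bullet>\<^bsub>B\<^esub> \<psi>) \<bullet>\<^bsub>C\<^esub> f"
    if h: "f \<in> hom C (ob F a) (ob G b)" "f' \<in> hom C (ob F a') (ob G b')"
      "f'' \<in> hom C (ob F a'') (ob G b'')"
      "\<phi> \<in> hom A a a'" "\<phi>' \<in> hom A a' a''" "\<psi> \<in> hom B b b'" "\<psi>' \<in> hom B b' b''"
      and e: "f' \<bullet>\<^bsub>C\<^esub> ar F \<phi> = ar G \<psi> \<bullet>\<^bsub>C\<^esub> f"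
        "f'' \<bullet>\<^bsub>C\<^esub> ar F \<phi>' = ar G \<psi>' \<bullet>\<^bsub>C\<^esub> f'"
    for a f b a' f' b' a'' f'' b'' \<phi> \<phi>' \<psi> \<psi>'
  proof -
    note k = h(1-3) F.ar_in_hom[OF h(4)] F.ar_in_hom[OF h(5)]
      G.ar_in_hom[OF h(6)] G.ar_in_hom[OF h(7)]
    have "f'' \<bullet>\<^bsub>C\<^esub> ar F (\<phi>' \<bullet>\<^bsub>A\<^esub> \<phi>) = (f'' \<bullet>\<^bsub>C\<^esub> ar F \<phi>') \<bullet>\<^bsub>C\<^esub> ar F \<phi>"
      using F.ar_Comp[OF h(4,5)] F.cod.Comp_assoc[OF k(4,5,3)] by simp
    also have "\<dots> = ar G \<psi>' \<bullet>\<^bsub>C\<^esub> (ar G \<psi> \<bullet>\<^bsub>C\<^esub> f)"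
      using F.cod.Comp_assoc[OF k(4,2,7)] e by simp
    also have "\<dots> = ar G (\<psi>' \<bullet>\<^bsub>B\<^esub> \<psi>) \<bullet>\<^bsub>C\<^esub> f"
      using F.cod.Comp_assoc[OF k(1,6,7)] G.ar_Comp[OF h(6,7)] by simp
    finally show ?thesis .
  qed
  show ?thesis
  proof
    fix k assume "k \<in> Arr (comma A B C F G)"
    then show "Dom (comma A B C F G) k \<in> Obj (comma A B C F G)"
      and "Cod (comma A B C F G) k \<in> Obj (comma A B C F G)"
      by (auto simp: comma_def comma_arrs_def)
  next
    fix X assume "X \<in> Obj (comma A B C F G)"
    then obtain a f b where X: "X = (a, f, b)"
      and h: "a \<in> Obj A" "b \<in> Obj B" "f \<in> hom C (ob F a) (ob G b)"
      by (auto simp: comma_def comma_objs_def)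
    have I: "Ident (comma A B C F G) X = (X, (Ident A a, Ident B b), X)"
      by (simp add: comma_def X)
    show "Ident (comma A B C F G) X \<in> hom (comma A B C F G) X X"
      unfolding I unfolding X hom_comma using h
      by (simp add: F.dom.Ident_in_hom G.dom.Ident_in_hom F.ar_Ident G.ar_Ident
          F.cod.Ident_left[OF h(3)] F.cod.Ident_right[OF h(3)])
  next
    fix X Y Z f g
    assume k: "f \<in> hom (comma A B C F G) X Y" "g \<in> hom (comma A B C F G) Y Z"
    obtain a u b a' u' b' a'' u'' b'' where
      XYZ: "X = (a, u, b)" "Y = (a', u', b')" "Z = (a'', u'', b'')"
      by (metis prod_cases3)
    obtain x1 y1 z1 \<phi> \<psi> x2 y2 z2 x3 y3 z3 \<phi>' \<psi>' x4 y4 z4 where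
      fg: "f = ((x1, y1, z1), (\<phi>, \<psi>), (x2, y2, z2))"
        "g = ((x3, y3, z3), (\<phi>', \<psi>'), (x4, y4, z4))"
      by (metis prod.exhaust)
    have gf: "g \<bullet>\<^bsub>comma A B C F G\<^esub> f =
        ((x1, y1, z1), (\<phi>' \<bullet>\<^bsub>A\<^esub> \<phi>, \<psi>' \<bullet>\<^bsub>B\<^esub> \<psi>), (x4, y4, z4))"
      by (simp add: comma_def fg)
    show "g \<bullet>\<^bsub>comma A B C F G\<^esub> f \<in> hom (comma A B C F G) X Z"
      using k comp[of u a b u' a' b' u'' a'' b'' \<phi> \<phi>' \<psi> \<psi>']
        F.dom.Comp_in_hom[of \<phi> a a' \<phi>' a''] G.dom.Comp_in_hom[of \<psi> b b' \<psi>' b'']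
      unfolding gf unfolding fg XYZ hom_comma by simp
  next
    fix f X Y assume k: "f \<in> hom (comma A B C F G) X Y"
    obtain a u b a' u' b' where XY: "X = (a, u, b)" "Y = (a', u', b')"
      by (metis prod_cases3)
    obtain x1 y1 z1 \<phi> \<psi> x2 y2 z2 where f: "f = ((x1, y1, z1), (\<phi>, \<psi>), (x2, y2, z2))"
      by (metis prod.exhaust)
    note k' = k[unfolded f XY hom_comma]
    show "Ident (comma A B C F G) Y \<bullet>\<^bsub>comma A B C F G\<^esub> f = f"
      and "f \<bullet>\<^bsub>comma A B C F G\<^esub> Ident (comma A B C F G) X = f"
      using k' F.dom.Ident_left[of \<phi> a a'] F.dom.Ident_right[of \<phi> a a']
        G.dom.Ident_left[of \<psi> b b'] G.dom.Ident_right[of \<psi> b b']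
      by (simp_all add: comma_def f XY)
  next
    fix f g h W X Y Z
    assume k: "f \<in> hom (comma A B C F G) W X" "g \<in> hom (comma A B C F G) X Y"
      "h \<in> hom (comma A B C F G) Y Z"
    obtain w x y z w1 x1 y1 z1 w2 x2 y2 z2 where
      O: "W = (w, w1, w2)" "X = (x, x1, x2)" "Y = (y, y1, y2)" "Z = (z, z1, z2)"
      by (metis prod_cases3)
    obtain a1 a2 a3 \<phi> \<psi> a4 a5 a6 where f: "f = ((a1, a2, a3), (\<phi>, \<psi>), (a4, a5, a6))"
      by (metis prod.exhaust)
    obtain b1 b2 b3 \<phi>' \<psi>' b4 b5 b6 where g: "g = ((b1, b2, b3), (\<phi>', \<psi>'), (b4, b5, b6))"
      by (metis prod.exhaust)
    obtain c1 c2 c3 \<phi>'' \<psi>'' c4 c5 c6 where h: "h = ((c1, c2, c3), (\<phi>'', \<psi>''), (c4, c5, c6))"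
      by (metis prod.exhaust)
    note k' = k[unfolded f g h O hom_comma]
    show "h \<bullet>\<^bsub>comma A B C F G\<^esub> (g \<bullet>\<^bsub>comma A B C F G\<^esub> f) =
        (h \<bullet>\<^bsub>comma A B C F G\<^esub> g) \<bullet>\<^bsub>comma A B C F G\<^esub> f"
      using k' F.dom.Comp_assoc[of \<phi> w x \<phi>' y \<phi>'' z]
        G.dom.Comp_assoc[of \<psi> w2 x2 \<psi>' y2 \<psi>'' z2]
      by (simp add: comma_def f g h)
  qed
qed

end

theory Submission imports Defs begin

text \<open>If \<open>e\<close> is the coequalizer of \<open>u\<close> and \<open>v\<close>, then \<open>f' \<circ> F(\<phi> u) = f' \<circ> F(\<phi> v)\<close> because
  \<open>f' \<circ> F \<phi> = G \<psi> \<circ> f\<close> factors through \<open>F e\<close>. As \<open>f'\<close> is monic and \<open>F\<close> is faithful,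
  \<open>\<phi> u = \<phi> v\<close>, so \<open>\<phi>\<close> descends along \<open>e\<close>. The descended arrow is a morphism of the comma
  category because \<open>F\<close>, being a left adjoint, sends \<open>e\<close> to an epimorphism. Images in a regular
  category come from the coequalizer of the kernel pair; the induced arrow is monic because
  regular epimorphisms are stable under pullback.\<close>

section \<open>Monomorphisms, epimorphisms and coequalizers\<close>

definition epimorphism :: "('o, 'm) cat \<Rightarrow> 'm \<Rightarrow> bool" where
  "epimorphism C e \<longleftrightarrow> e \<in> Arr C \<and>
     (\<forall>Z. \<forall>g \<in> hom C (Cod C e) Z. \<forall>h \<in> hom C (Cod C e) Z.
        g \<bullet>\<^bsub>C\<^esub> e = h \<bullet>\<^bsub>C\<^esub> e \<longrightarrow> g = h)"

lemma homD:
  assumes "f \<in> hom C X Y"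
  shows "f \<in> Arr C" "Dom C f = X" "Cod C f = Y"
  using assms by (auto simp: hom_def)

lemma monomorphismD:
  assumes "monomorphism C m" "m \<in> hom C X Y" "g \<in> hom C W X" "h \<in> hom C W X"
    and "m \<bullet>\<^bsub>C\<^esub> g = m \<bullet>\<^bsub>C\<^esub> h"
  shows "g = h"
  using assms by (auto simp: monomorphism_def hom_def)

lemma epimorphismD:
  assumes "epimorphism C e" "e \<in> hom C X Y" "g \<in> hom C Y Z" "h \<in> hom C Y Z"
    and "g \<bullet>\<^bsub>C\<^esub> e = h \<bullet>\<^bsub>C\<^esub> e"
  shows "g = h"
  using assms by (auto simp: epimorphism_def hom_def)

text \<open>\<open>coequalizer\<close> hides its objects under an existential. Since
  \<open>Dom\<close> and \<open>Cod\<close> are functions, the typing of \<open>e\<close> identifies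
  two of them with the given \<open>Y\<close> and \<open>Q\<close>, so the universal property
  becomes usable at known objects.\<close>

lemma coequalizerE:
  assumes "coequalizer C u v e" "e \<in> hom C Y Q"
  obtains X where "u \<in> hom C X Y" "v \<in> hom C X Y" "e \<bullet>\<^bsub>C\<^esub> u = e \<bullet>\<^bsub>C\<^esub> v"
    "\<And>Z h. h \<in> hom C Y Z \<Longrightarrow> h \<bullet>\<^bsub>C\<^esub> u = h \<bullet>\<^bsub>C\<^esub> v \<Longrightarrow> \<exists>!k. k \<in> hom C Q Z \<and> k \<bullet>\<^bsub>C\<^esub> e = h"
proof -
  obtain X Y' Q' where c: "u \<in> hom C X Y'" "v \<in> hom C X Y'" "e \<in> hom C Y' Q'"
    "e \<bullet>\<^bsub>C\<^esub> u = e \<bullet>\<^bsub>C\<^esub> v"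
    "\<forall>Z. \<forall>h \<in> hom C Y' Z. h \<bullet>\<^bsub>C\<^esub> u = h \<bullet>\<^bsub>C\<^esub> v \<longrightarrow> (\<exists>!k. k \<in> hom C Q' Z \<and> k \<bullet>\<^bsub>C\<^esub> e = h)"
    using assms(1) unfolding coequalizer_def by blast
  have "Y' = Y" "Q' = Q"
    using homD[OF c(3)] homD[OF assms(2)] by simp_all
  then show ?thesis
    using that[of X] c by blast
qed

context category
begin

lemma hom_ObjD:
  assumes "f \<in> hom C X Y"
  shows "X \<in> Obj C" "Y \<in> Obj C"
  using homD[OF assms] Dom_in_Obj[of f] Cod_in_Obj[of f] by auto

text \<open>If \<open>g \<bullet> e = h \<bullet> e\<close>, then \<open>g\<close> and
  \<open>h\<close> both factor the same arrow through the coequalizer, and such a factorization is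
  unique.\<close>

lemma regular_epi_imp_epimorphism:
  assumes "regular_epi C e"
  shows "epimorphism C e"
proof -
  obtain u v where c: "coequalizer C u v e"
    using assms by (auto simp: regular_epi_def)
  then obtain Y Q where e: "e \<in> hom C Y Q"
    by (auto simp: coequalizer_def)
  obtain X where u: "u \<in> hom C X Y" "v \<in> hom C X Y" "e \<bullet> u = e \<bullet> v"
    and univ: "\<And>Z h. h \<in> hom C Y Z \<Longrightarrow> h \<bullet> u = h \<bullet> v \<Longrightarrow> \<exists>!k. k \<in> hom C Q Z \<and> k \<bullet> e = h"
    using coequalizerE[OF c e] by metis
  have "g = h" if gh: "g \<in> hom C Q Z" "h \<in> hom C Q Z" "g \<bullet> e = h \<bullet> e" for Z g h
  proof -
    have "(g \<bullet> e) \<bullet> u = (g \<bullet> e) \<bullet> v"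
      using Comp_assoc[OF u(1) e gh(1)] Comp_assoc[OF u(2) e gh(1)] u(3) by simp
    then have "\<exists>!k. k \<in> hom C Q Z \<and> k \<bullet> e = g \<bullet> e"
      using univ Comp_in_hom[OF e gh(1)] by blast
    then show ?thesis
      using gh by metis
  qed
  then show ?thesis
    using homD[OF e] by (auto simp: epimorphism_def)
qed

end

section \<open>Pullbacks as limits over the cospan\<close>

text \<open>The category \<open>0 \<rightarrow> 2 \<leftarrow> 1\<close>: the arrows \<open>0, 1, 2\<close> are the identities, \<open>3\<close> and \<open>4\<close> the
  two legs.\<close>

definition cospan_cat :: "(nat, nat) cat" where
  "cospan_cat = \<lparr>Obj = {0, 1, 2}, Arr = {0, 1, 2, 3, 4},
     Dom = (\<lambda>k. if k = 3 then 0 else if k = 4 then 1 else k),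
     Cod = (\<lambda>k. if k = 3 \<or> k = 4 then 2 else k),
     Ident = (\<lambda>X. X),
     Comp = (\<lambda>g f. if g \<le> 2 then f else g)\<rparr>"

lemma Obj_cospan_cat: "Obj cospan_cat = {0, 1, 2}"
  by (simp add: cospan_cat_def)

lemma hom_cospan_cat:
  "k \<in> hom cospan_cat i j \<longleftrightarrow>
     (k = i \<and> i = j \<and> i \<in> {0, 1, 2}) \<or> (k = 3 \<and> i = 0 \<and> j = 2) \<or> (k = 4 \<and> i = 1 \<and> j = 2)"
  by (auto simp: hom_def cospan_cat_def)

text \<open>The two legs are never composable, so in every composite at least one factor is an
  identity. This is why the case split on \<open>g \<le> 2\<close> gives a correct
  composition.\<close>

lemma category_cospan_cat: "category cospan_cat"
proof
  fix f X Y assume "f \<in> hom cospan_cat X Y"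
  then show "Ident cospan_cat Y \<bullet>\<^bsub>cospan_cat\<^esub> f = f" "f \<bullet>\<^bsub>cospan_cat\<^esub> Ident cospan_cat X = f"
    unfolding hom_cospan_cat by (auto simp: cospan_cat_def)
next
  fix f g X Y Z assume "f \<in> hom cospan_cat X Y" "g \<in> hom cospan_cat Y Z"
  then show "g \<bullet>\<^bsub>cospan_cat\<^esub> f \<in> hom cospan_cat X Z"
    unfolding hom_cospan_cat by (auto simp: cospan_cat_def)
next
  fix f g h W X Y Z
  assume "f \<in> hom cospan_cat W X" "g \<in> hom cospan_cat X Y" "h \<in> hom cospan_cat Y Z"
  then show "h \<bullet>\<^bsub>cospan_cat\<^esub> (g \<bullet>\<^bsub>cospan_cat\<^esub> f) = (h \<bullet>\<^bsub>cospan_cat\<^esub> g) \<bullet>\<^bsub>cospan_cat\<^esub> f"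
    unfolding hom_cospan_cat by (auto simp: cospan_cat_def)
qed (auto simp: cospan_cat_def hom_def)

text \<open>The value at the object \<open>2\<close> is read off \<open>f\<close> alone, so this is
  a functor only when \<open>g\<close> has the same codomain as \<open>f\<close>, as the lemmas
  about it assume.\<close>

definition cospan_func :: "('o, 'm) cat \<Rightarrow> 'm \<Rightarrow> 'm \<Rightarrow> (nat, nat, 'o, 'm) func" where
  "cospan_func C f g =
     \<lparr>ob = (\<lambda>i. if i = 0 then Dom C f else if i = 1 then Dom C g else Cod C f),
      ar = (\<lambda>k. if k = 0 then Ident C (Dom C f) else if k = 1 then Ident C (Dom C g)
                else if k = 2 then Ident C (Cod C f) else if k = 3 then f else g)\<rparr>"

context category
begin

lemma is_functor_cospan_func:
  assumes f: "f \<in> hom C X Z" and g: "g \<in> hom C Y Z"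
  shows "is_functor cospan_cat C (cospan_func C f g)"
proof -
  note D = homD[OF f] homD[OF g]
  note O = hom_ObjD[OF f] hom_ObjD[OF g]
  note I = Ident_in_hom[OF O(1)] Ident_in_hom[OF O(2)] Ident_in_hom[OF O(3)]
  note L = Ident_left[OF f] Ident_left[OF g] Ident_right[OF f] Ident_right[OF g]
    Ident_left[OF I(1)] Ident_left[OF I(2)] Ident_left[OF I(3)]
  interpret J: category cospan_cat
    by (rule category_cospan_cat)
  show ?thesis
  proof
    fix k i j assume "k \<in> hom cospan_cat i j"
    then show "ar (cospan_func C f g) k
        \<in> hom C (ob (cospan_func C f g) i) (ob (cospan_func C f g) j)"
      unfolding hom_cospan_cat using f g I by (auto simp: cospan_func_def D)
  next
    fix k l i j n assume "k \<in> hom cospan_cat i j" "l \<in> hom cospan_cat j n"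
    then show "ar (cospan_func C f g) (l \<bullet>\<^bsub>cospan_cat\<^esub> k) =
        ar (cospan_func C f g) l \<bullet> ar (cospan_func C f g) k"
      unfolding hom_cospan_cat by (auto simp: cospan_func_def cospan_cat_def D L)
  qed (auto simp: cospan_func_def cospan_cat_def D O)
qed

text \<open>The component at \<open>2\<close> is forced by either leg. A cone therefore amounts to a
  commuting square, which is the data tested by a pullback.\<close>

lemma cone_cospan_iff:
  assumes f: "f \<in> hom C X Z" and g: "g \<in> hom C Y Z"
  shows "cone cospan_cat C (cospan_func C f g) T \<pi> \<longleftrightarrow>
    \<pi> 0 \<in> hom C T X \<and> \<pi> 1 \<in> hom C T Y \<and> \<pi> 2 = f \<bullet> \<pi> 0 \<and> f \<bullet> \<pi> 0 = g \<bullet> \<pi> 1"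
    (is "?L \<longleftrightarrow> ?R")
proof
  note D = homD[OF f] homD[OF g]
  assume ?L
  then have pi: "\<forall>j \<in> {0, 1, 2}. \<pi> j \<in> hom C T (ob (cospan_func C f g) j)"
    and ar: "\<And>i j a. a \<in> hom cospan_cat i j \<Longrightarrow> ar (cospan_func C f g) a \<bullet> \<pi> i = \<pi> j"
    by (auto simp: cone_def cospan_cat_def)
  have "f \<bullet> \<pi> 0 = \<pi> 2" "g \<bullet> \<pi> 1 = \<pi> 2"
    using ar[of 3 0 2] ar[of 4 1 2] by (simp_all add: hom_cospan_cat cospan_func_def)
  moreover have "\<pi> 0 \<in> hom C T X" "\<pi> 1 \<in> hom C T Y"
    using pi by (simp_all add: cospan_func_def D)
  ultimately show ?R by simp
next
  note D = homD[OF f] homD[OF g]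
  assume R: ?R
  then have "\<pi> 2 \<in> hom C T Z"
    using Comp_in_hom[of "\<pi> 0" T X f Z] f by auto
  with R show ?L
    by (auto simp: cone_def hom_cospan_cat Obj_cospan_cat cospan_func_def D hom_ObjD Ident_left)
qed

lemma finitely_complete_imp_pullback:
  assumes "finitely_complete C" and f: "f \<in> hom C X Z" and g: "g \<in> hom C Y Z"
  shows "\<exists>p q. pullback C f g p q"
proof -
  let ?D = "cospan_func C f g"
  have "finite (Obj cospan_cat)" "finite (Arr cospan_cat)"
    by (simp_all add: cospan_cat_def)
  then obtain P \<pi> where lim: "limit_cone cospan_cat C ?D P \<pi>"
    using assms(1) category_cospan_cat is_functor_cospan_func[OF f g]
    unfolding finitely_complete_def by blast
  then have \<pi>: "\<pi> 0 \<in> hom C P X" "\<pi> 1 \<in> hom C P Y" "\<pi> 2 = f \<bullet> \<pi> 0" "f \<bullet> \<pi> 0 = g \<bullet> \<pi> 1"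
    unfolding limit_cone_def cone_cospan_iff[OF f g] by auto
  have "\<exists>!t. t \<in> hom C T P \<and> \<pi> 0 \<bullet> t = x \<and> \<pi> 1 \<bullet> t = y"
    if xy: "x \<in> hom C T X" "y \<in> hom C T Y" "f \<bullet> x = g \<bullet> y" for T x y
  proof -
    \<comment> \<open>The square given by \<open>x\<close> and \<open>y\<close>, completed to a cone
      by its diagonal at index \<open>2\<close>.\<close>
    let ?\<sigma> = "\<lambda>i::nat. if i = 0 then x else if i = 1 then y else f \<bullet> x"
    have "cone cospan_cat C ?D T ?\<sigma>"
      unfolding cone_cospan_iff[OF f g] using xy by simp
    then have ex: "\<exists>!t. t \<in> hom C T P \<and> (\<forall>j \<in> Obj cospan_cat. \<pi> j \<bullet> t = ?\<sigma> j)"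
      using lim unfolding limit_cone_def by blast
    \<comment> \<open>The condition at index \<open>2\<close> follows from the one at
      \<open>0\<close>, because \<open>\<pi> 2 = f \<bullet> \<pi> 0\<close>. Hence the mediating
      arrows for the cone and for the square are the same.\<close>
    have "(t \<in> hom C T P \<and> (\<forall>j \<in> Obj cospan_cat. \<pi> j \<bullet> t = ?\<sigma> j)) \<longleftrightarrow>
        (t \<in> hom C T P \<and> \<pi> 0 \<bullet> t = x \<and> \<pi> 1 \<bullet> t = y)" for t
      using Comp_assoc[OF _ \<pi>(1) f, of t T] \<pi>(3) by (auto simp: cospan_cat_def)
    with ex show ?thesis by simp
  qed
  then show ?thesis
    unfolding pullback_def using f g \<pi> by blast
qed

end

section \<open>Regular epimorphisms and images in a regular category\<close>

lemma pullbackE: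
  assumes "pullback C f g p q" "f \<in> hom C X Z" "g \<in> hom C Y Z"
  obtains P where "p \<in> hom C P X" "q \<in> hom C P Y" "f \<bullet>\<^bsub>C\<^esub> p = g \<bullet>\<^bsub>C\<^esub> q"
    "\<And>T x y. x \<in> hom C T X \<Longrightarrow> y \<in> hom C T Y \<Longrightarrow> f \<bullet>\<^bsub>C\<^esub> x = g \<bullet>\<^bsub>C\<^esub> y \<Longrightarrow>
      \<exists>!t. t \<in> hom C T P \<and> p \<bullet>\<^bsub>C\<^esub> t = x \<and> q \<bullet>\<^bsub>C\<^esub> t = y"
proof -
  obtain X' Y' Z' P where c: "f \<in> hom C X' Z'" "g \<in> hom C Y' Z'"
    "p \<in> hom C P X'" "q \<in> hom C P Y'" "f \<bullet>\<^bsub>C\<^esub> p = g \<bullet>\<^bsub>C\<^esub> q"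
    "\<forall>T. \<forall>x \<in> hom C T X'. \<forall>y \<in> hom C T Y'. f \<bullet>\<^bsub>C\<^esub> x = g \<bullet>\<^bsub>C\<^esub> y \<longrightarrow>
      (\<exists>!t. t \<in> hom C T P \<and> p \<bullet>\<^bsub>C\<^esub> t = x \<and> q \<bullet>\<^bsub>C\<^esub> t = y)"
    using assms(1) unfolding pullback_def by blast
  have "X' = X" "Y' = Y"
    using homD[OF c(1)] homD[OF c(2)] homD[OF assms(2)] homD[OF assms(3)] by simp_all
  then show ?thesis
    using that[of P] c by blast
qed

text \<open>This is a local lifting principle: an arrow \<open>g\<close> into the codomain of a
  regular epimorphism \<open>e\<close> lifts along \<open>e\<close> after restriction along an
  epimorphism \<open>p\<close>. Stability under pullback makes \<open>p\<close> a regular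
  epimorphism.\<close>

lemma regular_category_pullback_regular_epi:
  assumes "regular_category C" "regular_epi C e" and e: "e \<in> hom C Y Z" and g: "g \<in> hom C X Z"
  obtains P p q where "p \<in> hom C P X" "q \<in> hom C P Y" "g \<bullet>\<^bsub>C\<^esub> p = e \<bullet>\<^bsub>C\<^esub> q" "epimorphism C p"
proof -
  interpret category C
    using assms(1) by (simp add: regular_category_def)
  obtain p q where pb: "pullback C g e p q"
    using finitely_complete_imp_pullback[OF _ g e] assms(1) by (auto simp: regular_category_def)
  then have "regular_epi C p"
    using assms(1,2) unfolding regular_category_def by blast
  then have "epimorphism C p"
    by (rule regular_epi_imp_epimorphism)
  obtain P where "p \<in> hom C P X" "q \<in> hom C P Y" "g \<bullet>\<^bsub>C\<^esub> p = e \<bullet>\<^bsub>C\<^esub> q"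
    using pullbackE[OF pb g e] .
  then show ?thesis
    using that \<open>epimorphism C p\<close> by blast
qed

text \<open>To see that the induced \<open>m\<close> is monic, two arrows identified by
  \<open>m\<close> are lifted along \<open>e\<close> on a common cover. Their lifts are identified
  by \<open>f\<close>, so they form a pair factoring through the kernel pair, and \<open>e\<close>
  identifies them.\<close>

lemma regular_category_image_factorization:
  fixes C (structure)
  assumes reg: "regular_category C" and f: "f \<in> hom C X Y"
  shows "\<exists>e m. image_factorization C f e m"
proof -
  interpret category C
    using reg by (simp add: regular_category_def)
  obtain p q where pb: "pullback C f f p q"
    using finitely_complete_imp_pullback[OF _ f f] reg by (auto simp: regular_category_def)
  obtain P where pq: "p \<in> hom C P X" "q \<in> hom C P X" "f \<bullet> p = f \<bullet> q"
    and pb_univ: "\<And>T x y. x \<in> hom C T X \<Longrightarrow> y \<in> hom C T X \<Longrightarrow> f \<bullet> x = f \<bullet> y \<Longrightarrow>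
      \<exists>!t. t \<in> hom C T P \<and> p \<bullet> t = x \<and> q \<bullet> t = y"
    using pullbackE[OF pb f f] by metis
  obtain e where coeq: "coequalizer C p q e"
    using pb reg unfolding regular_category_def by blast
  then have re: "regular_epi C e"
    by (auto simp: regular_epi_def)
  obtain X' Q where "p \<in> hom C P X'" and e': "e \<in> hom C X' Q"
    using coeq homD(2)[OF pq(1)] unfolding coequalizer_def by (auto simp: hom_def)
  then have e: "e \<in> hom C X Q"
    using pq(1) by (simp add: hom_def)
  have epq: "e \<bullet> p = e \<bullet> q"
    using coeq by (auto simp: coequalizer_def)
  obtain m where m: "m \<in> hom C Q Y" "m \<bullet> e = f"
    using coequalizerE[OF coeq e] f pq(3) by metis
  have "g = h" if gh: "g \<in> hom C W Q" "h \<in> hom C W Q" "m \<bullet> g = m \<bullet> h" for W g h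
  proof -
    \<comment> \<open>\<open>v\<close> covers \<open>W\<close>, and on this cover \<open>g\<close>
      lifts along \<open>e\<close> to \<open>x\<close>.\<close>
    obtain V v x where v: "v \<in> hom C V W" "x \<in> hom C V X" "g \<bullet> v = e \<bullet> x" "epimorphism C v"
      using regular_category_pullback_regular_epi[OF reg re e gh(1)] by metis
    have hv: "h \<bullet> v \<in> hom C V Q" and gv: "g \<bullet> v \<in> hom C V Q"
      using v(1) gh Comp_in_hom by blast+
    \<comment> \<open>A second cover, refining the first, makes \<open>h\<close> liftable as well;
      both lifts then live on \<open>U\<close>.\<close>
    obtain U u y where u: "u \<in> hom C U V" "y \<in> hom C U X" "(h \<bullet> v) \<bullet> u = e \<bullet> y" "epimorphism C u"
      using regular_category_pullback_regular_epi[OF reg re e hv] by metis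
    have xu: "x \<bullet> u \<in> hom C U X"
      using u(1) v(2) Comp_in_hom by blast
    have gvu: "(g \<bullet> v) \<bullet> u = e \<bullet> (x \<bullet> u)"
      using v(3) Comp_assoc[OF u(1) v(2) e] by simp
    have "f \<bullet> (x \<bullet> u) = m \<bullet> ((g \<bullet> v) \<bullet> u)"
      using Comp_assoc[OF xu e m(1)] m(2) gvu by simp
    also have "\<dots> = ((m \<bullet> g) \<bullet> v) \<bullet> u"
      using Comp_assoc[OF u(1) gv m(1)] Comp_assoc[OF v(1) gh(1) m(1)] by simp
    also have "\<dots> = m \<bullet> ((h \<bullet> v) \<bullet> u)"
      using Comp_assoc[OF u(1) hv m(1)] Comp_assoc[OF v(1) gh(2) m(1)] gh(3) by simp
    also have "\<dots> = f \<bullet> y"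
      using Comp_assoc[OF u(2) e m(1)] m(2) u(3) by simp
    \<comment> \<open>The lifts \<open>x \<bullet> u\<close> and \<open>y\<close> agree under
      \<open>f\<close>, so they are the two projections of one arrow \<open>t\<close> into the
      kernel pair.\<close>
    finally obtain t where t: "t \<in> hom C U P" "p \<bullet> t = x \<bullet> u" "q \<bullet> t = y"
      using pb_univ[OF xu u(2)] by blast
    have "(g \<bullet> v) \<bullet> u = (h \<bullet> v) \<bullet> u"
      using Comp_assoc[OF t(1) pq(1) e] Comp_assoc[OF t(1) pq(2) e] epq t gvu u(3) by simp
    \<comment> \<open>The covers are cancelled in the reverse order, first \<open>u\<close>, then
      \<open>v\<close>.\<close>
    then have "g \<bullet> v = h \<bullet> v"
      using epimorphismD[OF u(4,1) gv hv] by blast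
    then show "g = h"
      using epimorphismD[OF v(4,1) gh(1,2)] by blast
  qed
  then have "monomorphism C m"
    using homD[OF m(1)] by (auto simp: monomorphism_def)
  then show ?thesis
    using re m homD[OF m(1)] homD[OF e] by (auto simp: image_factorization_def)
qed

section \<open>Adjunctions, transposes and preservation of epimorphisms\<close>

locale adjunction = L: is_functor A C F + R: is_functor C A F'
  for A :: "('oa, 'ma) cat" and C :: "('oc, 'mc) cat" and F F' +
  fixes \<theta> :: "'oc \<Rightarrow> 'mc" and \<iota> :: "'oa \<Rightarrow> 'ma"
  assumes counit_in_hom: "Y \<in> Obj C \<Longrightarrow> \<theta> Y \<in> hom C (ob F (ob F' Y)) Y"
    and counit_natural: "f \<in> hom C X Y \<Longrightarrow> \<theta> Y \<bullet>\<^bsub>C\<^esub> ar F (ar F' f) = f \<bullet>\<^bsub>C\<^esub> \<theta> X"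
    and unit_in_hom: "W \<in> Obj A \<Longrightarrow> \<iota> W \<in> hom A W (ob F' (ob F W))"
    and unit_natural: "g \<in> hom A V W \<Longrightarrow> \<iota> W \<bullet>\<^bsub>A\<^esub> g = ar F' (ar F g) \<bullet>\<^bsub>A\<^esub> \<iota> V"
    and triangle_left: "W \<in> Obj A \<Longrightarrow> \<theta> (ob F W) \<bullet>\<^bsub>C\<^esub> ar F (\<iota> W) = Ident C (ob F W)"
    and triangle_right: "Y \<in> Obj C \<Longrightarrow> ar F' (\<theta> Y) \<bullet>\<^bsub>A\<^esub> \<iota> (ob F' Y) = Ident A (ob F' Y)"

text \<open>The unit exists only under an existential in \<open>right_adjoint_with_counit\<close>.
  Here one is chosen as a locale parameter, and naturality is unfolded from \<open>comp_func\<close>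
  and \<open>id_func\<close> to plain equations.\<close>

lemma right_adjoint_with_counit_imp_adjunction:
  assumes "right_adjoint_with_counit A C F F' \<theta>"
  obtains \<iota> where "adjunction A C F F' \<theta> \<iota>"
proof -
  obtain \<iota> where \<iota>: "nat_trans A A id_func (comp_func F' F) \<iota>"
    "\<forall>X \<in> Obj A. \<theta> (ob F X) \<bullet>\<^bsub>C\<^esub> ar F (\<iota> X) = Ident C (ob F X)"
    "\<forall>Y \<in> Obj C. ar F' (\<theta> Y) \<bullet>\<^bsub>A\<^esub> \<iota> (ob F' Y) = Ident A (ob F' Y)"
    and \<theta>: "is_functor A C F" "is_functor C A F'" "nat_trans C C (comp_func F F') id_func \<theta>"
    using assms unfolding right_adjoint_with_counit_def by blast
  have "adjunction A C F F' \<theta> \<iota>"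
    using \<iota> \<theta> unfolding adjunction_def adjunction_axioms_def nat_trans_def
    by (auto simp: comp_func_def id_func_def)
  then show ?thesis ..
qed

context adjunction
begin

text \<open>Naturality of the counit at \<open>g\<close> moves \<open>g\<close> to the front, and
  the triangle identity at \<open>a\<close> cancels what remains.\<close>

lemma counit_transpose:
  assumes a: "a \<in> Obj A" and g: "g \<in> hom C (ob F a) c"
  shows "ar F' g \<bullet>\<^bsub>A\<^esub> \<iota> a \<in> hom A a (ob F' c)"
    and "\<theta> c \<bullet>\<^bsub>C\<^esub> ar F (ar F' g \<bullet>\<^bsub>A\<^esub> \<iota> a) = g"
proof -
  note i = unit_in_hom[OF a] and Rg = R.ar_in_hom[OF g]
  note O = L.cod.hom_ObjD[OF g]
  show "ar F' g \<bullet>\<^bsub>A\<^esub> \<iota> a \<in> hom A a (ob F' c)"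
    using L.dom.Comp_in_hom[OF i Rg] .
  have "\<theta> c \<bullet>\<^bsub>C\<^esub> ar F (ar F' g \<bullet>\<^bsub>A\<^esub> \<iota> a) = (\<theta> c \<bullet>\<^bsub>C\<^esub> ar F (ar F' g)) \<bullet>\<^bsub>C\<^esub> ar F (\<iota> a)"
    using L.ar_Comp[OF i Rg]
      L.cod.Comp_assoc[OF L.ar_in_hom[OF i] L.ar_in_hom[OF Rg] counit_in_hom[OF O(2)]] by simp
  also have "\<dots> = g \<bullet>\<^bsub>C\<^esub> (\<theta> (ob F a) \<bullet>\<^bsub>C\<^esub> ar F (\<iota> a))"
    using counit_natural[OF g] L.cod.Comp_assoc[OF L.ar_in_hom[OF i] counit_in_hom[OF O(1)] g]
    by simp
  also have "\<dots> = g"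
    using triangle_left[OF a] L.cod.Ident_right[OF g] by simp
  finally show "\<theta> c \<bullet>\<^bsub>C\<^esub> ar F (ar F' g \<bullet>\<^bsub>A\<^esub> \<iota> a) = g" .
qed

text \<open>Dual to \<open>counit_transpose\<close>: naturality of the unit at \<open>x\<close>,
  then the triangle identity at \<open>c\<close>.\<close>

lemma transpose_counit:
  assumes c: "c \<in> Obj C" and x: "x \<in> hom A a (ob F' c)"
  shows "ar F' (\<theta> c \<bullet>\<^bsub>C\<^esub> ar F x) \<bullet>\<^bsub>A\<^esub> \<iota> a = x"
proof -
  note O = L.dom.hom_ObjD[OF x] and Fx = L.ar_in_hom[OF x] and t = counit_in_hom[OF c]
  have "ar F' (\<theta> c \<bullet>\<^bsub>C\<^esub> ar F x) \<bullet>\<^bsub>A\<^esub> \<iota> a = ar F' (\<theta> c) \<bullet>\<^bsub>A\<^esub> (ar F' (ar F x) \<bullet>\<^bsub>A\<^esub> \<iota> a)"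
    using R.ar_Comp[OF Fx t]
      L.dom.Comp_assoc[OF unit_in_hom[OF O(1)] R.ar_in_hom[OF Fx] R.ar_in_hom[OF t]] by simp
  also have "\<dots> = (ar F' (\<theta> c) \<bullet>\<^bsub>A\<^esub> \<iota> (ob F' c)) \<bullet>\<^bsub>A\<^esub> x"
    using unit_natural[OF x] L.dom.Comp_assoc[OF x unit_in_hom[OF O(2)] R.ar_in_hom[OF t]] by simp
  also have "\<dots> = x"
    using triangle_right[OF c] L.dom.Ident_left[OF x] by simp
  finally show ?thesis .
qed

text \<open>The two preceding lemmas make transposition a bijection between
  \<open>hom C (ob F a) c\<close> and \<open>hom A a (ob F' c)\<close>.\<close>

lemma ex1_transpose:
  assumes "a \<in> Obj A" "g \<in> hom C (ob F a) c"
  shows "\<exists>!x. x \<in> hom A a (ob F' c) \<and> \<theta> c \<bullet>\<^bsub>C\<^esub> ar F x = g"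
  using counit_transpose[OF assms] transpose_counit[OF L.cod.hom_ObjD(2)[OF assms(2)]] by metis

text \<open>Transposition turns precomposition with \<open>ar F e\<close> into precomposition with
  \<open>e\<close>. There \<open>e\<close> can be cancelled, and transposition is injective.\<close>

lemma preserves_epimorphism:
  assumes epi: "epimorphism A e"
  shows "epimorphism C (ar F e)"
proof -
  define a q where "a = Dom A e" and "q = Cod A e"
  then have e: "e \<in> hom A a q"
    using epi by (simp add: epimorphism_def hom_def)
  note O = L.dom.hom_ObjD[OF e] and Fe = L.ar_in_hom[OF e]
  \<comment> \<open>Naturality of transposition in its first argument.\<close>
  have *: "(ar F' g \<bullet>\<^bsub>A\<^esub> \<iota> q) \<bullet>\<^bsub>A\<^esub> e = ar F' (g \<bullet>\<^bsub>C\<^esub> ar F e) \<bullet>\<^bsub>A\<^esub> \<iota> a"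
    if g: "g \<in> hom C (ob F q) z" for g z
    using L.dom.Comp_assoc[OF e unit_in_hom[OF O(2)] R.ar_in_hom[OF g]] unit_natural[OF e]
      L.dom.Comp_assoc[OF unit_in_hom[OF O(1)] R.ar_in_hom[OF Fe] R.ar_in_hom[OF g]]
      R.ar_Comp[OF Fe g] by simp
  have "g = h" if gh: "g \<in> hom C (ob F q) z" "h \<in> hom C (ob F q) z"
      "g \<bullet>\<^bsub>C\<^esub> ar F e = h \<bullet>\<^bsub>C\<^esub> ar F e" for g h z
  proof -
    have "(ar F' g \<bullet>\<^bsub>A\<^esub> \<iota> q) \<bullet>\<^bsub>A\<^esub> e = (ar F' h \<bullet>\<^bsub>A\<^esub> \<iota> q) \<bullet>\<^bsub>A\<^esub> e"
      unfolding *[OF gh(1)] *[OF gh(2)] gh(3) ..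
    then have "ar F' g \<bullet>\<^bsub>A\<^esub> \<iota> q = ar F' h \<bullet>\<^bsub>A\<^esub> \<iota> q"
      by (rule epimorphismD[OF epi e counit_transpose(1)[OF O(2) gh(1)]
            counit_transpose(1)[OF O(2) gh(2)]])
    then show ?thesis
      using counit_transpose(2)[OF O(2) gh(1)] counit_transpose(2)[OF O(2) gh(2)] by metis
  qed
  then show ?thesis
    using homD[OF Fe] by (auto simp: epimorphism_def)
qed

end

section \<open>The universal property of the simplification\<close>

text \<open>The existence of the transpose and of its image factorization is part of the conclusion,
  so the quantification over \<open>fh\<close>, \<open>e\<close> and \<open>m\<close> is not
  vacuous. The universal property holds for every choice of factorization.\<close>

theorem mainTheorem5:
  fixes A :: "('oa, 'ma) cat" and B :: "('ob, 'mb) cat" and C :: "('oc, 'mc) cat"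
    and F :: "('oa, 'ma, 'oc, 'mc) func" and G :: "('ob, 'mb, 'oc, 'mc) func"
    and F' :: "('oc, 'mc, 'oa, 'ma) func" and \<theta> :: "'oc \<Rightarrow> 'mc"
    and X :: "('oa, 'mc, 'ob) comma_obj"
  assumes "is_functor A C F" and "is_functor B C G"
    and "regular_category A" and "faithful A F"
    and "right_adjoint_with_counit A C F F' \<theta>"
    and "X \<in> Obj (comma A B C F G)"
  shows "(\<exists>!fh. is_transpose A C F G F' \<theta> X fh) \<and>
    (\<forall>fh. is_transpose A C F G F' \<theta> X fh \<longrightarrow>
      (\<exists>e m. image_factorization A fh e m) \<and>
      (\<forall>e m. image_factorization A fh e m \<longrightarrow>
        simplification A C F G \<theta> m X \<in> Obj (comma A B C F G) \<and>
        simplification_unit A B C F G \<theta> e m X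
          \<in> hom (comma A B C F G) X (simplification A C F G \<theta> m X) \<and>
        (\<forall>X' k. X' \<in> Obj (comma A B C F G) \<and> simple_obj C X' \<and>
            k \<in> hom (comma A B C F G) X X' \<longrightarrow>
          (\<exists>!h. h \<in> hom (comma A B C F G) (simplification A C F G \<theta> m X) X' \<and>
                h \<bullet>\<^bsub>comma A B C F G\<^esub> simplification_unit A B C F G \<theta> e m X = k))))"
proof -
  interpret F: is_functor A C F by fact
  interpret G: is_functor B C G by fact
  obtain \<iota> where "adjunction A C F F' \<theta> \<iota>"
    using right_adjoint_with_counit_imp_adjunction[OF assms(5)] .
  then interpret adj: adjunction A C F F' \<theta> \<iota> .
  obtain a f b where X: "X = (a, f, b)" and ab: "a \<in> Obj A" "b \<in> Obj B"
    and f: "f \<in> hom C (ob F a) (ob G b)"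
    using assms(6) by (auto simp: comma_def comma_objs_def)
  have tr: "is_transpose A C F G F' \<theta> X fh \<longleftrightarrow>
      fh \<in> hom A a (ob F' (ob G b)) \<and> \<theta> (ob G b) \<bullet>\<^bsub>C\<^esub> ar F fh = f" for fh
    by (simp add: is_transpose_def X)
  note th = adj.counit_in_hom[OF G.ob_in_Obj[OF ab(2)]]
  have im: "\<exists>e m. image_factorization A fh e m" if "is_transpose A C F G F' \<theta> X fh" for fh
    using that tr regular_category_image_factorization[OF assms(3)] by blast
  have obj: "simplification A C F G \<theta> m X \<in> Obj (comma A B C F G)" (is ?obj)
    and unit: "simplification_unit A B C F G \<theta> e m X
        \<in> hom (comma A B C F G) X (simplification A C F G \<theta> m X)" (is ?unit)
    and univ: "X' \<in> Obj (comma A B C F G) \<and> simple_obj C X' \<and> k \<in> hom (comma A B C F G) X X' \<Longrightarrow>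
        \<exists>!h. h \<in> hom (comma A B C F G) (simplification A C F G \<theta> m X) X' \<and>
          h \<bullet>\<^bsub>comma A B C F G\<^esub> simplification_unit A B C F G \<theta> e m X = k" (is "?pre \<Longrightarrow> ?univ")
    if "is_transpose A C F G F' \<theta> X fh" and im: "image_factorization A fh e m"
    for fh e m X' k
  proof -
    have fh: "fh \<in> hom A a (ob F' (ob G b))" "\<theta> (ob G b) \<bullet>\<^bsub>C\<^esub> ar F fh = f"
      using that(1) tr by auto
    have re: "regular_epi A e" and em: "Cod A e = Dom A m" "m \<bullet>\<^bsub>A\<^esub> e = fh"
      and "monomorphism A m"
      using im by (auto simp: image_factorization_def)
    define r where "r = Dom A m"
    have epi: "epimorphism A e"
      using F.dom.regular_epi_imp_epimorphism[OF re] .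
    \<comment> \<open>\<open>image_factorization\<close> fixes only the middle object
      \<open>r\<close>. The outer endpoints of \<open>e\<close> and \<open>m\<close> are found by
      comparing the typing of their composite with that of \<open>fh\<close>.\<close>
    have "e \<in> hom A (Dom A e) r" "m \<in> hom A r (Cod A m)"
      using epi \<open>monomorphism A m\<close> em by (auto simp: epimorphism_def monomorphism_def hom_def r_def)
    moreover from this have "fh \<in> hom A (Dom A e) (Cod A m)"
      using F.dom.Comp_in_hom em(2) by blast
    ultimately have e: "e \<in> hom A a r" and m: "m \<in> hom A r (ob F' (ob G b))"
      using fh(1) by (auto simp: hom_def)
    note Fe = F.ar_in_hom[OF e] and Fm = F.ar_in_hom[OF m]
    \<comment> \<open>\<open>s\<close> is the structure arrow of the simplified object; the equation
      \<open>se\<close> below is the commuting square of the unit.\<close>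
    define s where "s = \<theta> (ob G b) \<bullet>\<^bsub>C\<^esub> ar F m"
    have s: "s \<in> hom C (ob F r) (ob G b)"
      unfolding s_def using F.cod.Comp_in_hom[OF Fm th] .
    have se: "s \<bullet>\<^bsub>C\<^esub> ar F e = f"
      unfolding s_def
      using F.cod.Comp_assoc[OF Fe Fm th] F.ar_Comp[OF e m] em(2) fh(2) by simp
    have S: "simplification A C F G \<theta> m X = (r, s, b)"
      by (simp add: simplification_def X r_def s_def)
    have U: "simplification_unit A B C F G \<theta> e m X = ((a, f, b), (e, Ident B b), (r, s, b))"
      using S by (simp add: simplification_unit_def X)
    have r: "r \<in> Obj A"
      using F.dom.hom_ObjD[OF e] by simp
    show ?obj
      unfolding S using r ab s by (simp add: comma_def comma_objs_def)
    show ?unit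
      unfolding S U unfolding X hom_comma
      using r ab f s e se G.dom.Ident_in_hom[OF ab(2)] G.ar_Ident[OF ab(2)] F.cod.Ident_left[OF f]
      by simp
    show ?univ if pre: ?pre
    proof -
      obtain a' f' b' where X': "X' = (a', f', b')"
        by (cases X') auto
      obtain x1 y1 z1 \<phi> \<psi> x2 y2 z2 where k: "k = ((x1, y1, z1), (\<phi>, \<psi>), (x2, y2, z2))"
        by (metis prod.exhaust)
      have mono: "monomorphism C f'"
        using pre by (simp add: simple_obj_def X')
      have "k \<in> hom (comma A B C F G) X X'"
        using pre by blast
      then have k': "k = ((a, f, b), (\<phi>, \<psi>), (a', f', b'))"
        and ab': "a' \<in> Obj A" "b' \<in> Obj B" and f': "f' \<in> hom C (ob F a') (ob G b')"
        and \<phi>: "\<phi> \<in> hom A a a'" and \<psi>: "\<psi> \<in> hom B b b'"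
        and sq: "f' \<bullet>\<^bsub>C\<^esub> ar F \<phi> = ar G \<psi> \<bullet>\<^bsub>C\<^esub> f"
        unfolding k X X' hom_comma by auto
      note F\<phi> = F.ar_in_hom[OF \<phi>] and G\<psi> = G.ar_in_hom[OF \<psi>]
      obtain u v where c: "coequalizer A u v e"
        using re by (auto simp: regular_epi_def)
      obtain w where u: "u \<in> hom A w a" and v: "v \<in> hom A w a" and uv: "e \<bullet>\<^bsub>A\<^esub> u = e \<bullet>\<^bsub>A\<^esub> v"
        and univ: "\<And>Z h. h \<in> hom A a Z \<Longrightarrow> h \<bullet>\<^bsub>A\<^esub> u = h \<bullet>\<^bsub>A\<^esub> v \<Longrightarrow>
          \<exists>!k. k \<in> hom A r Z \<and> k \<bullet>\<^bsub>A\<^esub> e = h"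
        using coequalizerE[OF c e] by metis
      have Gs: "ar G \<psi> \<bullet>\<^bsub>C\<^esub> s \<in> hom C (ob F r) (ob G b')"
        using F.cod.Comp_in_hom[OF s G\<psi>] .
      have sq': "f' \<bullet>\<^bsub>C\<^esub> ar F \<phi> = (ar G \<psi> \<bullet>\<^bsub>C\<^esub> s) \<bullet>\<^bsub>C\<^esub> ar F e"
        using sq se F.cod.Comp_assoc[OF Fe s G\<psi>] by simp
      have *: "f' \<bullet>\<^bsub>C\<^esub> ar F (\<phi> \<bullet>\<^bsub>A\<^esub> x) = (ar G \<psi> \<bullet>\<^bsub>C\<^esub> s) \<bullet>\<^bsub>C\<^esub> ar F (e \<bullet>\<^bsub>A\<^esub> x)"
        if x: "x \<in> hom A w a" for x
        using F.ar_Comp[OF x \<phi>] F.ar_Comp[OF x e] sq'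
          F.cod.Comp_assoc[OF F.ar_in_hom[OF x] F\<phi> f']
          F.cod.Comp_assoc[OF F.ar_in_hom[OF x] Fe Gs] by simp
      note \<phi>u = F.dom.Comp_in_hom[OF u \<phi>] and \<phi>v = F.dom.Comp_in_hom[OF v \<phi>]
      have "f' \<bullet>\<^bsub>C\<^esub> ar F (\<phi> \<bullet>\<^bsub>A\<^esub> u) = f' \<bullet>\<^bsub>C\<^esub> ar F (\<phi> \<bullet>\<^bsub>A\<^esub> v)"
        unfolding *[OF u] *[OF v] uv ..
      then have "ar F (\<phi> \<bullet>\<^bsub>A\<^esub> u) = ar F (\<phi> \<bullet>\<^bsub>A\<^esub> v)"
        by (rule monomorphismD[OF mono f' F.ar_in_hom[OF \<phi>u] F.ar_in_hom[OF \<phi>v]])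
      then have "\<phi> \<bullet>\<^bsub>A\<^esub> u = \<phi> \<bullet>\<^bsub>A\<^esub> v"
        using assms(4) \<phi>u \<phi>v F.dom.hom_ObjD[OF \<phi>u] unfolding faithful_def by (meson inj_onD)
      then obtain \<phi>' where \<phi>': "\<phi>' \<in> hom A r a'" "\<phi>' \<bullet>\<^bsub>A\<^esub> e = \<phi>"
        using univ[OF \<phi>] by blast
      note F\<phi>' = F.ar_in_hom[OF \<phi>'(1)]
      \<comment> \<open>The comma square for \<open>(\<phi>', \<psi>)\<close> is known only after
        precomposition with \<open>ar F e\<close>; this arrow is cancelled as an
        epimorphism.\<close>
      have "(f' \<bullet>\<^bsub>C\<^esub> ar F \<phi>') \<bullet>\<^bsub>C\<^esub> ar F e = (ar G \<psi> \<bullet>\<^bsub>C\<^esub> s) \<bullet>\<^bsub>C\<^esub> ar F e"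
        using sq' F.cod.Comp_assoc[OF Fe F\<phi>' f'] F.ar_Comp[OF e \<phi>'(1)] \<phi>'(2) by simp
      then have sq'': "f' \<bullet>\<^bsub>C\<^esub> ar F \<phi>' = ar G \<psi> \<bullet>\<^bsub>C\<^esub> s"
        using epimorphismD[OF adj.preserves_epimorphism[OF epi] Fe F.cod.Comp_in_hom[OF F\<phi>' f'] Gs]
        by blast
      show ?univ
        unfolding S U
      \<comment> \<open>The second component must be \<open>\<psi>\<close> itself, since that of the
        unit is the identity on \<open>b\<close>.\<close>
      proof (rule ex1I[of _ "((r, s, b), (\<phi>', \<psi>), (a', f', b'))"])
        show "((r, s, b), (\<phi>', \<psi>), (a', f', b')) \<in> hom (comma A B C F G) (r, s, b) X' \<and>
          ((r, s, b), (\<phi>', \<psi>), (a', f', b')) \<bullet>\<^bsub>comma A B C F G\<^esub>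
            ((a, f, b), (e, Ident B b), (r, s, b)) = k"
          unfolding X' hom_comma k'
          using r ab ab' s f' \<phi>' \<psi> sq'' G.dom.Ident_right[OF \<psi>] by (simp add: comma_def)
      next
        fix h assume h: "h \<in> hom (comma A B C F G) (r, s, b) X' \<and>
          h \<bullet>\<^bsub>comma A B C F G\<^esub> ((a, f, b), (e, Ident B b), (r, s, b)) = k"
        obtain x1 y1 z1 \<phi>'' \<psi>'' x2 y2 z2 where
          h_eq: "h = ((x1, y1, z1), (\<phi>'', \<psi>''), (x2, y2, z2))"
          by (metis prod.exhaust)
        have h': "h = ((r, s, b), (\<phi>'', \<psi>''), (a', f', b'))" "\<phi>'' \<in> hom A r a'" "\<psi>'' \<in> hom B b b'"
          using h unfolding h_eq X' hom_comma by auto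
        have "\<phi>'' \<bullet>\<^bsub>A\<^esub> e = \<phi>" "\<psi>'' \<bullet>\<^bsub>B\<^esub> Ident B b = \<psi>"
          using h unfolding h'(1) k' by (simp_all add: comma_def)
        \<comment> \<open>The first components agree because \<open>e\<close> is an epimorphism, the
          second ones by the identity law in \<open>B\<close>.\<close>
        then have "\<phi>'' = \<phi>'" "\<psi>'' = \<psi>"
          using epimorphismD[OF epi e h'(2) \<phi>'(1)] \<phi>'(2) G.dom.Ident_right[OF h'(3)] by metis+
        then show "h = ((r, s, b), (\<phi>', \<psi>), (a', f', b'))"
          using h'(1) by simp
      qed
    qed
  qed
  have ex1: "\<exists>!fh. is_transpose A C F G F' \<theta> X fh"
    unfolding tr using adj.ex1_transpose[OF ab(1) f] .
  show ?thesis
    by (intro conjI allI impI) (fact ex1, erule im, erule (1) obj, erule (1) unit, erule (2) univ)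
qed

end
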